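(* Consider a system of two qubits $S$ and $A$ with dynamical Lie algebra $$\mathcal L=\mathrm{span}\{\sigma_z\otimes\mathbf 1,\ \mathbf 1\otimes\mathfrak{su}(2),\ i\sigma_x\otimes\mathfrak{su}(2),\ i\sigma_y\otimes\mathfrak{su}(2)\}\subseteq\mathfrak{su}(4).$$ Then the system is pure unitary indirectly controllable (pure UIC): for every $2\times2$ density matrix $\rho_S$ and every $X_S\in SU(2)$ there exist a pure state $\rho_A$ of $A$ and $X\in e^{\mathcal L}$ such that $$\mathrm{Tr}_A\bigl(X(\rho_S\otimes\rho_A)X^\dagger\bigr)=X_S\rho_SX_S^\dagger .$$
   Context: $\mathbf 1$ is the $2\times2$ identity; $\mathfrak{su}(2)$ is the real Lie algebra of traceless skew-Hermitian $2\times2$ matrices; spans are over $\mathbb R$, and $M\otimes\mathfrak{su}(2)=\{M\otimes\tau:\tau\in\mathfrak{su}(2)\}$. Here $\sigma_x=\frac i2\begin{pmatrix}0&1\\1&0\end{pmatrix}$, $\sigma_y=\frac i2\begin{pmatrix}0&i\\-i&0\end{pmatrix}$, $\sigma_z=\frac i2\begin{pmatrix}1&0\\0&-1\end{pmatrix}$. The first tensor factor is $S$, the second is $A$. $e^{\mathcal L}$ is the connected Lie group with Lie algebra $\mathcal L$ (the group generated by exponentials of elements of $\mathcal L$); it is the set of unitary evolutions attainable for $S+A$. A density matrix is a Hermitian positive semidefinite matrix of trace $1$; a pure state is a rank-one density matrix $|\psi\rangle\langle\psi|$. $\mathrm{Tr}_A$ is the linear map with $\mathrm{Tr}_A(P\otimes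 Q)=\mathrm{Tr}(Q)P$. UIC given a set $\Lambda_A$ of initial states of $A$ means that for every $\rho_S$ every density matrix unitarily equivalent to $\rho_S$ can be written as $\mathrm{Tr}_A(X(\rho_S\otimes\rho_A)X^\dagger)$ with $\rho_A\in\Lambda_A$ and $X\in e^{\mathcal L}$; it is called pure when $\Lambda_A$ is the set of all pure states of $A$. *)

theory Defs
  imports "HOL-Analysis.Analysis"
begin

section \<open>Complex matrices\<close>

text \<open>
  The library instances of \<open>*\<close>, \<open>1\<close> and \<open>^\<close> on vectors are componentwise. Matrix products
  below are therefore always \<open>**\<close>, the identity is \<^term>\<open>mat 1\<close>, and powers, exponential and
  complex multiples of matrices are introduced here.
\<close>

definition cscale :: "complex \<Rightarrow> complex^'n^'m \<Rightarrow> complex^'n^'m"  (infixr \<open>*\<^sub>C\<close> 80)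
  where "c *\<^sub>C M = (\<chi> i j. c * M $ i $ j)"

definition dagger :: "complex^'n^'m \<Rightarrow> complex^'m^'n"  (\<open>_\<^sup>\<dagger>\<close> [1000] 999)
  where "M\<^sup>\<dagger> = (\<chi> i j. cnj (M $ j $ i))"

primrec matpow :: "complex^'n^'n \<Rightarrow> nat \<Rightarrow> complex^'n^'n" where
  "matpow M 0 = mat 1"
| "matpow M (Suc k) = M ** matpow M k"

definition mexp :: "complex^'n^'n \<Rightarrow> complex^'n^'n"
  where "mexp M = (\<Sum>k. matpow M k /\<^sub>R fact k)"

definition unitary :: "complex^'n^'n \<Rightarrow> bool"
  where "unitary U \<longleftrightarrow> U\<^sup>\<dagger> ** U = mat 1 \<and> U ** U\<^sup>\<dagger> = mat 1"

definition special_unitary :: "complex^'n^'n \<Rightarrow> bool"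
  where "special_unitary U \<longleftrightarrow> unitary U \<and> det U = 1"

definition su_algebra :: "(complex^'n^'n) set"
  where "su_algebra = {M. M\<^sup>\<dagger> = - M \<and> trace M = 0}"

text \<open>
  The exponential series converges, so \<^term>\<open>suminf\<close> in the definition of \<^term>\<open>mexp\<close> is
  its actual sum.
\<close>

lemma matpow_entry_bound:
  fixes M :: "complex^'n^'n"
  defines "c \<equiv> \<Sum>a\<in>UNIV. \<Sum>b\<in>UNIV. norm (M $ a $ b)"
  shows "norm (matpow M k $ i $ j) \<le> c ^ k"
proof (induction k arbitrary: i j)
  case 0
  show ?case by (simp add: mat_def)
next
  case (Suc k)
  have "0 \<le> c" unfolding c_def by (intro sum_nonneg norm_ge_zero)
  then have ck: "0 \<le> c ^ k" by (rule zero_le_power)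
  have row: "(\<Sum>l\<in>UNIV. norm (M $ i $ l)) \<le> c"
    unfolding c_def
    by (rule member_le_sum[where f = "\<lambda>a. \<Sum>b\<in>UNIV. norm (M $ a $ b)"])
       (simp_all add: sum_nonneg)
  have "norm (matpow M (Suc k) $ i $ j) \<le> (\<Sum>l\<in>UNIV. norm (M $ i $ l * matpow M k $ l $ j))"
    by (simp add: matrix_matrix_mult_def norm_sum)
  also have "\<dots> \<le> (\<Sum>l\<in>UNIV. norm (M $ i $ l) * c ^ k)"
    unfolding norm_mult by (intro sum_mono mult_left_mono Suc.IH norm_ge_zero)
  also have "\<dots> = (\<Sum>l\<in>UNIV. norm (M $ i $ l)) * c ^ k"
    by (rule sum_distrib_right[symmetric])
  also have "\<dots> \<le> c * c ^ k"
    by (rule mult_right_mono[OF row ck])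
  finally show ?case by simp
qed

lemma mexp_sums:
  fixes M :: "complex^'n^'n"
  shows "(\<lambda>k. matpow M k /\<^sub>R fact k) sums mexp M"
proof -
  define c where "c = (\<Sum>a\<in>UNIV. \<Sum>b\<in>UNIV. norm (M $ a $ b))"
  define N where "N = real CARD('n)"
  have bound: "norm (matpow M k /\<^sub>R fact k) \<le> N * N * (c ^ k /\<^sub>R fact k)" for k
  proof -
    have "norm (matpow M k) \<le> (\<Sum>i\<in>UNIV. norm (matpow M k $ i))"
      unfolding norm_vec_def[of "matpow M k"] by (rule L2_set_le_sum) simp
    also have "\<dots> \<le> (\<Sum>i::'n\<in>UNIV. \<Sum>j::'n\<in>UNIV. norm (matpow M k $ i $ j))"
      by (rule sum_mono) (simp add: norm_vec_def L2_set_le_sum)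
    also have "\<dots> \<le> (\<Sum>i::'n\<in>UNIV. \<Sum>j::'n\<in>UNIV. c ^ k)"
      unfolding c_def by (intro sum_mono matpow_entry_bound)
    also have "\<dots> = N * N * c ^ k" by (simp add: N_def)
    finally have "norm (matpow M k) / fact k \<le> N * N * c ^ k / fact k"
      by (rule divide_right_mono) simp
    then show ?thesis by (simp add: divide_inverse mult.commute mult.left_commute)
  qed
  have "summable (\<lambda>k. N * N * (c ^ k /\<^sub>R fact k))"
    by (rule summable_mult[OF summable_exp_generic])
  then have "summable (\<lambda>k. matpow M k /\<^sub>R fact k)"
    by (rule summable_comparison_test'[where N = 0]) (rule bound)
  then show ?thesis unfolding mexp_def by (rule summable_sums)
qed

section \<open>Generated Lie group, states, tensor product and partial trace\<close>

inductive_set exp_group :: "(complex^'n^'n) set \<Rightarrow> (complex^'n^'n) set"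
  for L :: "(complex^'n^'n) set" where
  exp_group_one: "mat 1 \<in> exp_group L"
| exp_group_exp: "M \<in> L \<Longrightarrow> mexp M \<in> exp_group L"
| exp_group_mult: "X \<in> exp_group L \<Longrightarrow> Y \<in> exp_group L \<Longrightarrow> X ** Y \<in> exp_group L"
| exp_group_inv: "X \<in> exp_group L \<Longrightarrow> matrix_inv X \<in> exp_group L"

definition density_matrix :: "complex^'n^'n \<Rightarrow> bool"
  where "density_matrix R \<longleftrightarrow>
    R\<^sup>\<dagger> = R \<and>
    (\<forall>v :: complex^'n. 0 \<le> Re (\<Sum>i\<in>UNIV. \<Sum>j\<in>UNIV. cnj (v $ i) * R $ i $ j * v $ j)) \<and>
    trace R = 1"

definition pure_state :: "complex^'n^'n \<Rightarrow> bool"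
  where "pure_state R \<longleftrightarrow> density_matrix R \<and> rank R = 1"

text \<open>Rows and columns of a matrix on the composite system are indexed by pairs.\<close>

definition kron :: "complex^'s^'s \<Rightarrow> complex^'a^'a \<Rightarrow> complex^('s::finite \<times> 'a::finite)^('s \<times> 'a)"
    (infixl \<open>\<otimes>\<close> 75)
  where "P \<otimes> Q = (\<chi> p q. P $ fst p $ fst q * Q $ snd p $ snd q)"

definition partial_trace_A :: "complex^('s::finite \<times> 'a::finite)^('s \<times> 'a) \<Rightarrow> complex^'s^'s"
  where "partial_trace_A M = (\<chi> i j. \<Sum>k\<in>UNIV. M $ (i, k) $ (j, k))"

lemma partial_trace_A_kron: "partial_trace_A (P \<otimes> Q) = trace Q *\<^sub>C P"
  by (simp add: partial_trace_A_def kron_def cscale_def trace_def vec_eq_iff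
      sum_distrib_left[symmetric] mult.commute)

lemma partial_trace_A_add: "partial_trace_A (M + N) = partial_trace_A M + partial_trace_A N"
  by (simp add: partial_trace_A_def vec_eq_iff sum.distrib)

lemma partial_trace_A_cscale: "partial_trace_A (c *\<^sub>C M) = c *\<^sub>C partial_trace_A M"
  by (simp add: partial_trace_A_def cscale_def vec_eq_iff sum_distrib_left)

section \<open>Unitary indirect controllability\<close>

definition UIC :: "(complex^('s::finite \<times> 'a::finite)^('s \<times> 'a)) set \<Rightarrow> (complex^'a^'a) set \<Rightarrow> bool"
  where "UIC L \<Lambda> \<longleftrightarrow>
    (\<forall>R R'. density_matrix R \<longrightarrow> density_matrix R' \<longrightarrow> (\<exists>U. unitary U \<and> R' = U ** R ** U\<^sup>\<dagger>) \<longrightarrow>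
       (\<exists>R\<^sub>A\<in>\<Lambda>. \<exists>X\<in>exp_group L. partial_trace_A (X ** (R \<otimes> R\<^sub>A) ** X\<^sup>\<dagger>) = R'))"

definition pure_UIC :: "(complex^('s::finite \<times> 'a::finite)^('s \<times> 'a)) set \<Rightarrow> bool"
  where "pure_UIC L \<longleftrightarrow> UIC L {R. pure_state R}"

section \<open>The two-qubit dynamical Lie algebra\<close>

definition \<sigma>\<^sub>x :: "complex^2^2"
  where "\<sigma>\<^sub>x = (\<i> / 2) *\<^sub>C vector [vector [0, 1], vector [1, 0]]"

definition \<sigma>\<^sub>y :: "complex^2^2"
  where "\<sigma>\<^sub>y = (\<i> / 2) *\<^sub>C vector [vector [0, \<i>], vector [- \<i>, 0]]"

definition \<sigma>\<^sub>z :: "complex^2^2"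
  where "\<sigma>\<^sub>z = (\<i> / 2) *\<^sub>C vector [vector [1, 0], vector [0, -1]]"

text \<open>
  \<^term>\<open>span\<close> is the real linear span. The index type \<open>2 \<times> 2\<close> has four elements, so these are
  complex \<open>4 \<times> 4\<close> matrices.
\<close>

definition dyn_algebra :: "(complex^(2 \<times> 2)^(2 \<times> 2)) set"
  where "dyn_algebra = span
    ({\<sigma>\<^sub>z \<otimes> mat 1} \<union>
     {mat 1 \<otimes> T | T. T \<in> su_algebra} \<union>
     {(\<i> *\<^sub>C \<sigma>\<^sub>x) \<otimes> T | T. T \<in> su_algebra} \<union>
     {(\<i> *\<^sub>C \<sigma>\<^sub>y) \<otimes> T | T. T \<in> su_algebra})"

lemma subspace_su_algebra: "subspace (su_algebra :: (complex^'n^'n) set)"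
  by (auto simp: subspace_def su_algebra_def dagger_def trace_def vec_eq_iff sum.distrib
      scaleR_sum_right[symmetric])

lemma dagger_kron: "(P \<otimes> Q)\<^sup>\<dagger> = P\<^sup>\<dagger> \<otimes> Q\<^sup>\<dagger>"
  by (simp add: dagger_def kron_def vec_eq_iff)

lemma trace_kron: "trace (P \<otimes> Q) = trace P * trace Q"
  by (simp add: trace_def kron_def sum_product UNIV_Times_UNIV[symmetric]
      sum.cartesian_product case_prod_unfold del: UNIV_Times_UNIV)

lemma kron_uminus: "P \<otimes> (- Q) = - (P \<otimes> Q)" "(- P) \<otimes> Q = - (P \<otimes> Q)"
  by (simp_all add: kron_def vec_eq_iff)

lemma dyn_algebra_subset_su: "dyn_algebra \<subseteq> su_algebra"
  unfolding dyn_algebra_def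
proof (rule span_minimal[OF _ subspace_su_algebra])
  have 1: "(mat 1 :: complex^2^2)\<^sup>\<dagger> = mat 1" by (simp add: dagger_def mat_def vec_eq_iff)
  have z: "\<sigma>\<^sub>z\<^sup>\<dagger> = - \<sigma>\<^sub>z" "trace \<sigma>\<^sub>z = 0"
    by (simp_all add: dagger_def \<sigma>\<^sub>z_def cscale_def vec_eq_iff forall_2 trace_def sum_2)
  have x: "(\<i> *\<^sub>C \<sigma>\<^sub>x)\<^sup>\<dagger> = \<i> *\<^sub>C \<sigma>\<^sub>x"
    by (simp add: dagger_def \<sigma>\<^sub>x_def cscale_def vec_eq_iff forall_2)
  have y: "(\<i> *\<^sub>C \<sigma>\<^sub>y)\<^sup>\<dagger> = \<i> *\<^sub>C \<sigma>\<^sub>y"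
    by (simp add: dagger_def \<sigma>\<^sub>y_def cscale_def vec_eq_iff forall_2)
  show "{\<sigma>\<^sub>z \<otimes> mat 1} \<union> {mat 1 \<otimes> T | T. T \<in> su_algebra} \<union>
     {(\<i> *\<^sub>C \<sigma>\<^sub>x) \<otimes> T | T. T \<in> su_algebra} \<union> {(\<i> *\<^sub>C \<sigma>\<^sub>y) \<otimes> T | T. T \<in> su_algebra}
     \<subseteq> (su_algebra :: (complex^(2 \<times> 2)^(2 \<times> 2)) set)"
    using 1 z x y by (auto simp: su_algebra_def dagger_kron trace_kron kron_uminus)
qed

end

theory Submission
  imports Defs
begin

text \<open>
  On the subspace \<open>\<complex>\<^sup>2 \<otimes> e\<^sub>1\<close> the ancilla generator \<open>diag(-\<i>, \<i>)\<close> is the scalar \<open>-\<i>\<close>, so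
  \<open>\<i>\<sigma>\<^sub>x \<otimes> diag(-\<i>, \<i>)\<close> acts there as \<open>\<sigma>\<^sub>x \<otimes> \<one>\<close>. Together with \<open>\<sigma>\<^sub>z \<otimes> \<one>\<close> it
  generates all of \<open>SU(2)\<close> on \<open>S\<close> by the Euler decomposition, and the ancilla never leaves \<open>e\<^sub>1\<close>.
  Hence the single pure state \<open>e\<^sub>1e\<^sub>1\<^sup>\<dagger>\<close> works for all \<open>\<rho>\<^sub>S\<close> and all targets.
\<close>

section \<open>Operators preserving a product subspace\<close>

text \<open>\<open>acts_as a M P\<close> says that \<open>M (v \<otimes> e\<^sub>a) = P v \<otimes> e\<^sub>a\<close> for all \<open>v\<close>.\<close>

definition acts_as ::
  "'a::finite \<Rightarrow> complex^('s::finite \<times> 'a)^('s \<times> 'a) \<Rightarrow> complex^'s^'s \<Rightarrow> bool"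
  where "acts_as a M P \<longleftrightarrow> (\<forall>i j k. M $ (i, k) $ (j, a) = (if k = a then P $ i $ j else 0))"

definition basis_projector :: "'a::finite \<Rightarrow> complex^'a^'a"
  where "basis_projector a = (\<chi> i j. if i = a \<and> j = a then 1 else 0)"

lemma sum_UNIV_prod:
  "(\<Sum>p\<in>UNIV. f p) = (\<Sum>i\<in>UNIV. \<Sum>k\<in>UNIV. f (i :: 's::finite, k :: 'a::finite))"
  by (simp add: sum.cartesian_product)

lemma acts_as_one: "acts_as a (mat 1) (mat 1)"
  by (auto simp: acts_as_def mat_def)

text \<open>\<open>N\<close> keeps the slice with ancilla index \<open>a\<close> invariant, so only
  the columns of \<open>M\<close> on that slice contribute to the product there.\<close>

lemma acts_as_mult:
  assumes "acts_as a M P" "acts_as a N Q"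
  shows "acts_as a (M ** N) (P ** Q)"
  unfolding acts_as_def
proof (intro allI)
  fix i j k
  have "(M ** N) $ (i, k) $ (j, a) =
      (\<Sum>m\<in>UNIV. \<Sum>l\<in>UNIV. M $ (i, k) $ (m, l) * (if l = a then Q $ m $ j else 0))"
    using assms(2) by (simp add: acts_as_def matrix_matrix_mult_def sum_UNIV_prod)
  also have "\<dots> = (\<Sum>m\<in>UNIV. M $ (i, k) $ (m, a) * Q $ m $ j)"
    by (simp add: if_distrib[of "\<lambda>x. _ * x"] sum.delta cong: if_cong)
  also have "\<dots> = (if k = a then (P ** Q) $ i $ j else 0)"
    using assms(1) by (simp add: acts_as_def matrix_matrix_mult_def)
  finally show "(M ** N) $ (i, k) $ (j, a) = (if k = a then (P ** Q) $ i $ j else 0)" .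
qed

lemma acts_as_matpow: "acts_as a M P \<Longrightarrow> acts_as a (matpow M k) (matpow P k)"
  by (induction k) (simp_all add: acts_as_one acts_as_mult)

lemma mexp_entry_sums:
  "(\<lambda>k. matpow M k $ i $ j /\<^sub>R fact k) sums (mexp M $ i $ j)"
  using bounded_linear.sums[OF bounded_linear_vec_nth
      bounded_linear.sums[OF bounded_linear_vec_nth mexp_sums]]
  by simp

text \<open>The powers agree on the slice entry by entry, and so do the sums of their exponential
  series.\<close>

lemma acts_as_mexp:
  assumes "acts_as a M P"
  shows "acts_as a (mexp M) (mexp P)"
  unfolding acts_as_def
proof (intro allI)
  fix i j k
  have "(\<lambda>n. matpow M n $ (i, k) $ (j, a) /\<^sub>R fact n) sums (if k = a then mexp P $ i $ j else 0)"
    using acts_as_matpow[OF assms] mexp_entry_sums[of P i j] by (simp add: acts_as_def)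
  then show "mexp M $ (i, k) $ (j, a) = (if k = a then mexp P $ i $ j else 0)"
    using mexp_entry_sums sums_unique2 by blast
qed

text \<open>The input is supported on the slice, where \<open>X\<close> is \<open>P\<close>, so the
  evolved state is \<open>(P ** R ** P\<^sup>\<dagger>) \<otimes> basis_projector a\<close>, whose
  second factor has trace 1.\<close>

lemma partial_trace_A_acts_as:
  assumes "acts_as a X P"
  shows "partial_trace_A (X ** (R \<otimes> basis_projector a) ** X\<^sup>\<dagger>) = P ** R ** P\<^sup>\<dagger>"
proof -
  have 1: "(X ** (R \<otimes> basis_projector a)) $ (i, k) $ (j, l) =
      (if k = a \<and> l = a then (P ** R) $ i $ j else 0)" for i j k l
    using assms
    by (auto simp: acts_as_def matrix_matrix_mult_def sum_UNIV_prod kron_def basis_projector_def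
        if_distrib sum.delta cong: if_cong)
  have 2: "(X ** (R \<otimes> basis_projector a) ** X\<^sup>\<dagger>) $ (i, k) $ (j, k) =
      (if k = a then (P ** R ** P\<^sup>\<dagger>) $ i $ j else 0)" for i j k
  proof -
    have "(X ** (R \<otimes> basis_projector a) ** X\<^sup>\<dagger>) $ (i, k) $ (j, k) =
      (\<Sum>m\<in>UNIV. \<Sum>l\<in>UNIV. (X ** (R \<otimes> basis_projector a)) $ (i, k) $ (m, l) *
        cnj (X $ (j, k) $ (m, l)))"
      by (simp add: matrix_matrix_mult_def[of "X ** _"] sum_UNIV_prod dagger_def)
    also have "\<dots> = (if k = a then \<Sum>m\<in>UNIV. (P ** R) $ i $ m * cnj (X $ (j, k) $ (m, a)) else 0)"
      by (cases "k = a") (simp_all add: 1 if_distrib[of "\<lambda>x. x * _"] sum.delta cong: if_cong)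
    also have "\<dots> = (if k = a then (P ** R ** P\<^sup>\<dagger>) $ i $ j else 0)"
      using assms by (simp add: acts_as_def matrix_matrix_mult_def[of "P ** R"] dagger_def)
    finally show ?thesis .
  qed
  show ?thesis
    by (simp add: partial_trace_A_def vec_eq_iff 2)
qed

lemma pure_state_basis_projector: "pure_state (basis_projector a)"
proof -
  \<comment> \<open>The rank is computed as row rank: the zero rows do not change the span, and one
    nonzero row remains.\<close>
  have "rows (basis_projector a) - {0} = {axis a 1}"
  proof -
    have "row i (basis_projector a) = (if i = a then axis a 1 else 0)" for i
      by (auto simp: row_def basis_projector_def axis_def vec_eq_iff)
    then show ?thesis by (auto simp: rows_def axis_eq_0_iff)
  qed
  moreover have "vec.dim (rows (basis_projector a) - {0}) = vec.dim (rows (basis_projector a))"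
    by (metis vec.dim_span vec.span_delete_0)
  ultimately have "rank (basis_projector a) = vec.dim {axis a (1::complex)}"
    by (simp add: row_rank_def_gen)
  also have "\<dots> = 1"
    by (subst vec.dim_eq_card_independent) (simp_all add: axis_eq_0_iff)
  finally have "rank (basis_projector a) = 1" .
  moreover have "density_matrix (basis_projector a)"
  proof -
    have "(\<Sum>i\<in>UNIV. \<Sum>j\<in>UNIV. cnj (v $ i) * basis_projector a $ i $ j * v $ j) =
        cnj (v $ a) * v $ a" for v
    proof -
      have "(\<Sum>j\<in>UNIV. cnj (v $ i) * basis_projector a $ i $ j * v $ j) =
          (if i = a then cnj (v $ a) * v $ a else 0)" for i
        by (simp add: basis_projector_def if_distrib[of "\<lambda>x. _ * x * _"] if_distrib[of "\<lambda>x. x * _"]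
            sum.delta cong: if_cong)
      then show ?thesis by (simp add: sum.delta)
    qed
    then show ?thesis
      by (auto simp: density_matrix_def basis_projector_def dagger_def trace_def vec_eq_iff)
  qed
  ultimately show ?thesis by (simp add: pure_state_def)
qed

section \<open>Euler decomposition of SU(2)\<close>

text \<open>Euler's formula, with \<open>J\<close> in the role of the imaginary unit.\<close>

lemma mexp_square_minus_one:
  fixes J :: "complex^'n^'n"
  assumes "J ** J = - mat 1"
  shows "mexp (t *\<^sub>R J) = cos t *\<^sub>R mat 1 + sin t *\<^sub>R J"
proof -
  \<comment> \<open>\<open>cos_coeff\<close> vanishes at odd and \<open>sin_coeff\<close> at even
    indices, so one formula covers both parities. Multiplication by \<open>J\<close> swaps the two
    terms, and the sign from \<open>J ** J\<close> is the one in
    \<open>cos_coeff_Suc\<close>.\<close>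
  have pow: "matpow (t *\<^sub>R J) k /\<^sub>R fact k =
      (cos_coeff k *\<^sub>R t ^ k) *\<^sub>R mat 1 + (sin_coeff k *\<^sub>R t ^ k) *\<^sub>R J" for k
  proof (induction k)
    case 0
    show ?case by simp
  next
    case (Suc k)
    have "matpow (t *\<^sub>R J) (Suc k) /\<^sub>R fact (Suc k) =
        (t / Suc k) *\<^sub>R (J ** (matpow (t *\<^sub>R J) k /\<^sub>R fact k))"
      by (simp add: scalar_matrix_assoc[symmetric] matrix_scalar_ac divide_inverse mult_ac)
    also have "\<dots> = (t / Suc k) *\<^sub>R
        ((cos_coeff k *\<^sub>R t ^ k) *\<^sub>R J - (sin_coeff k *\<^sub>R t ^ k) *\<^sub>R mat 1)"
      unfolding Suc.IH by (simp add: matrix_add_ldistrib matrix_scalar_ac scalar_matrix_assoc[symmetric] assms)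
    also have "\<dots> = (cos_coeff (Suc k) *\<^sub>R t ^ Suc k) *\<^sub>R mat 1 +
        (sin_coeff (Suc k) *\<^sub>R t ^ Suc k) *\<^sub>R J"
      by (simp add: cos_coeff_Suc sin_coeff_Suc algebra_simps)
    finally show ?case .
  qed
  have "(\<lambda>k. matpow (t *\<^sub>R J) k /\<^sub>R fact k) sums (cos t *\<^sub>R mat 1 + sin t *\<^sub>R J)"
    unfolding pow
    by (intro sums_add bounded_linear.sums[OF bounded_linear_scaleR_left]
        cos_converges sin_converges)
  then show ?thesis using mexp_sums sums_unique2 by blast
qed

lemma special_unitary_2_entries:
  fixes X :: "complex^2^2"
  assumes "special_unitary X"
  shows "X $ 2 $ 2 = cnj (X $ 1 $ 1)" "X $ 2 $ 1 = - cnj (X $ 1 $ 2)"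
    "(norm (X $ 1 $ 1))\<^sup>2 + (norm (X $ 1 $ 2))\<^sup>2 = 1"
proof -
  define a b c d where "a = X $ 1 $ 1" "b = X $ 1 $ 2" "c = X $ 2 $ 1" "d = X $ 2 $ 2"
  note defs = a_b_c_d_def
  have det: "a * d - b * c = 1"
    using assms by (simp add: special_unitary_def det_2 defs)
  have u1: "X\<^sup>\<dagger> ** X = mat 1" and u2: "X ** X\<^sup>\<dagger> = mat 1"
    using assms by (simp_all add: special_unitary_def unitary_def)
  have e: "cnj a * a + cnj c * c = 1" "cnj a * b + cnj c * d = 0"
    "cnj b * b + cnj d * d = 1" "cnj b * a + cnj d * c = 0"
    using u1 by (simp_all add: vec_eq_iff forall_2 matrix_matrix_mult_def sum_2 dagger_def mat_def defs)
  have n: "a * cnj a + b * cnj b = 1"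
    using u2 by (simp add: vec_eq_iff forall_2 matrix_matrix_mult_def sum_2 dagger_def mat_def defs)
  \<comment> \<open>Multiply \<open>d\<close> by the squared norm of the first column, replace
    \<open>cnj c * d\<close> by \<open>- cnj a * b\<close>, and recognise the determinant. The
    second column gives \<open>c\<close> in the same way.\<close>
  have "d = cnj a" using det e(1,2) by algebra
  moreover have "c = - cnj b" using det e(3,4) by algebra
  moreover have "(norm a)\<^sup>2 + (norm b)\<^sup>2 = 1"
    using n by (metis complex_norm_square of_real_add of_real_eq_1_iff)
  ultimately show "X $ 2 $ 2 = cnj (X $ 1 $ 1)" "X $ 2 $ 1 = - cnj (X $ 1 $ 2)"
    "(norm (X $ 1 $ 1))\<^sup>2 + (norm (X $ 1 $ 2))\<^sup>2 = 1"
    by (simp_all add: defs)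
qed

text \<open>Because of the factor 1/2 in \<open>\<sigma>\<^sub>x\<close>, it is
  \<open>2 *\<^sub>R \<sigma>\<^sub>x\<close> that squares to minus the identity; hence the doubled
  parameter.\<close>

lemma mexp_sigma_x:
  "mexp ((2 * t) *\<^sub>R \<sigma>\<^sub>x) =
    vector [vector [of_real (cos t), \<i> * of_real (sin t)], vector [\<i> * of_real (sin t), of_real (cos t)]]"
proof -
  have "(2 *\<^sub>R \<sigma>\<^sub>x) ** (2 *\<^sub>R \<sigma>\<^sub>x) = - mat 1"
    by (simp add: \<sigma>\<^sub>x_def cscale_def vec_eq_iff forall_2 matrix_matrix_mult_def sum_2 mat_def
        scaleR_conv_of_real[where 'a = complex])
  from mexp_square_minus_one[OF this, of t] show ?thesis
    by (simp add: \<sigma>\<^sub>x_def cscale_def vec_eq_iff forall_2 mat_def scaleR_conv_of_real[where 'a = complex] mult_ac)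
qed

lemma mexp_sigma_z:
  "mexp ((2 * t) *\<^sub>R \<sigma>\<^sub>z) = vector [vector [cis t, 0], vector [0, cis (- t)]]"
proof -
  have "(2 *\<^sub>R \<sigma>\<^sub>z) ** (2 *\<^sub>R \<sigma>\<^sub>z) = - mat 1"
    by (simp add: \<sigma>\<^sub>z_def cscale_def vec_eq_iff forall_2 matrix_matrix_mult_def sum_2 mat_def
        scaleR_conv_of_real[where 'a = complex])
  from mexp_square_minus_one[OF this, of t] show ?thesis
    by (simp add: \<sigma>\<^sub>z_def cscale_def vec_eq_iff forall_2 mat_def scaleR_conv_of_real[where 'a = complex] mult_ac
        complex_eq_iff)
qed

lemma special_unitary_euler:
  assumes "special_unitary X"
  obtains r s t where "X = mexp (r *\<^sub>R \<sigma>\<^sub>z) ** mexp (s *\<^sub>R \<sigma>\<^sub>x) ** mexp (t *\<^sub>R \<sigma>\<^sub>z)"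
proof -
  note entries = special_unitary_2_entries[OF assms]
  obtain \<theta> where \<theta>: "norm (X $ 1 $ 1) = cos \<theta>" "norm (X $ 1 $ 2) = sin \<theta>"
    using sincos_total_2pi[OF entries(3)] by metis
  \<comment> \<open>The shift by \<open>pi / 2\<close> absorbs the factor \<open>\<i>\<close> of the
    off-diagonal entries in \<open>mexp_sigma_x\<close>. If an entry is zero, its modulus vanishes
    and any phase will do.\<close>
  define \<phi> \<psi> where "\<phi> = Arg (X $ 1 $ 1)" "\<psi> = Arg (X $ 1 $ 2) - pi / 2"
  note angles = \<phi>_\<psi>_def
  have a: "X $ 1 $ 1 = of_real (cos \<theta>) * cis \<phi>"
    using rcis_cmod_Arg[of "X $ 1 $ 1"] by (simp add: rcis_def \<theta> angles)
  have "X $ 1 $ 2 = of_real (sin \<theta>) * cis (\<psi> + pi / 2)"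
    using rcis_cmod_Arg[of "X $ 1 $ 2"] by (simp add: rcis_def \<theta> angles)
  then have b: "X $ 1 $ 2 = \<i> * of_real (sin \<theta>) * cis \<psi>"
    by (simp add: cis_mult[symmetric] mult_ac)
  \<comment> \<open>In the product below the entry (1,1) has phase \<alpha> + \<beta> and the entry
    (1,2) has phase \<alpha> - \<beta>, apart from \<open>\<i>\<close>; solve for both. The second
    row is determined by the first.\<close>
  define \<alpha> \<beta> where "\<alpha> = (\<phi> + \<psi>) / 2" "\<beta> = (\<phi> - \<psi>) / 2"
  then have *: "\<phi> = \<alpha> + \<beta>" "\<psi> = \<alpha> - \<beta>" by (simp_all add: field_simps)
  have "X = mexp ((2 * \<alpha>) *\<^sub>R \<sigma>\<^sub>z) ** mexp ((2 * \<theta>) *\<^sub>R \<sigma>\<^sub>x) ** mexp ((2 * \<beta>) *\<^sub>R \<sigma>\<^sub>z)"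
    unfolding mexp_sigma_x mexp_sigma_z
    by (simp add: vec_eq_iff forall_2 matrix_matrix_mult_def sum_2 entries(1,2) a b * cis_cnj
        cis_mult[symmetric] cis_divide[symmetric] cis_inverse[symmetric] field_simps)
  then show ?thesis by (rule that)
qed

text \<open>Bridges the arbitrary unitaries in \<open>UIC\<close> and the Euler decomposition, which
  needs determinant 1.\<close>

lemma unitary_phase_special_unitary:
  fixes U :: "complex^2^2"
  assumes "unitary U"
  obtains c where "norm c = 1" "special_unitary (c *\<^sub>C U)"
proof -
  have "det (U\<^sup>\<dagger>) = cnj (det U)" by (simp add: det_2 dagger_def mult.commute)
  moreover have "det (U\<^sup>\<dagger>) * det U = 1"
    using assms by (metis det_I det_mul unitary_def)
  ultimately have n: "norm (det U) = 1"
    by (metis complex_mod_cnj norm_mult norm_one norm_ge_zero abs_of_nonneg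
        power2_eq_square power2_eq_1_iff abs_1 abs_minus)
  \<comment> \<open>In dimension 2 a scalar \<open>c\<close> multiplies the determinant by its
    square.\<close>
  define c where "c = csqrt (inverse (det U))"
  have c2: "c * c * det U = 1"
    using n by (metis c_def norm_zero zero_neq_one left_inverse power2_csqrt power2_eq_square)
  have "norm c = 1" using n by (simp add: c_def norm_inverse)
  then have cc: "c * cnj c = 1" by (simp add: complex_norm_square[symmetric])
  have "(c *\<^sub>C U)\<^sup>\<dagger> ** (c *\<^sub>C U) = (c * cnj c) *\<^sub>C (U\<^sup>\<dagger> ** U)"
    "(c *\<^sub>C U) ** (c *\<^sub>C U)\<^sup>\<dagger> = (c * cnj c) *\<^sub>C (U ** U\<^sup>\<dagger>)"
    by (simp_all add: cscale_def dagger_def matrix_matrix_mult_def vec_eq_iff sum_distrib_left mult_ac)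
  then have "unitary (c *\<^sub>C U)"
    using assms cc by (simp add: unitary_def cscale_def vec_eq_iff)
  moreover have "det (c *\<^sub>C U) = 1"
    using c2 by (simp add: det_2 cscale_def algebra_simps)
  ultimately show ?thesis
    using that \<open>norm c = 1\<close> by (simp add: special_unitary_def)
qed

lemma cscale_conj:
  assumes "norm c = 1"
  shows "(c *\<^sub>C U) ** R ** (c *\<^sub>C U)\<^sup>\<dagger> = U ** R ** U\<^sup>\<dagger>"
proof -
  have "(c *\<^sub>C U) ** R ** (c *\<^sub>C U)\<^sup>\<dagger> = (c * cnj c) *\<^sub>C (U ** R ** U\<^sup>\<dagger>)"
    by (simp add: cscale_def dagger_def matrix_matrix_mult_def vec_eq_iff sum_distrib_left
        sum_distrib_right mult_ac)
  also have "c * cnj c = 1" using assms by (simp add: complex_norm_square[symmetric])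
  finally show ?thesis by (simp add: cscale_def vec_eq_iff)
qed

section \<open>Controllability\<close>

text \<open>Every slice works, since the generator is the identity on the ancilla.\<close>

lemma exp_group_acts_as_sigma_z:
  "\<exists>Y\<in>exp_group dyn_algebra. acts_as a Y (mexp (t *\<^sub>R \<sigma>\<^sub>z))"
proof
  have "\<sigma>\<^sub>z \<otimes> mat 1 \<in> dyn_algebra"
    unfolding dyn_algebra_def by (rule span_base) simp
  then show "mexp (t *\<^sub>R (\<sigma>\<^sub>z \<otimes> mat 1)) \<in> exp_group dyn_algebra"
    unfolding dyn_algebra_def by (intro exp_group_exp span_scale)
  show "acts_as a (mexp (t *\<^sub>R (\<sigma>\<^sub>z \<otimes> mat 1))) (mexp (t *\<^sub>R \<sigma>\<^sub>z))"
    by (rule acts_as_mexp) (simp add: acts_as_def kron_def mat_def)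
qed

text \<open>Here the slice matters: on the other ancilla basis vector the same generator acts as
  \<open>- \<sigma>\<^sub>x\<close>.\<close>

lemma exp_group_acts_as_sigma_x:
  "\<exists>Y\<in>exp_group dyn_algebra. acts_as 1 Y (mexp (t *\<^sub>R \<sigma>\<^sub>x))"
proof
  define T :: "complex^2^2" where "T = vector [vector [- \<i>, 0], vector [0, \<i>]]"
  have "T \<in> su_algebra"
    by (simp add: T_def su_algebra_def dagger_def vec_eq_iff forall_2 trace_def sum_2)
  then have "(\<i> *\<^sub>C \<sigma>\<^sub>x) \<otimes> T \<in> dyn_algebra"
    unfolding dyn_algebra_def by (intro span_base) blast
  then show "mexp (t *\<^sub>R ((\<i> *\<^sub>C \<sigma>\<^sub>x) \<otimes> T)) \<in> exp_group dyn_algebra"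
    unfolding dyn_algebra_def by (intro exp_group_exp span_scale)
  have "acts_as 1 (t *\<^sub>R ((\<i> *\<^sub>C \<sigma>\<^sub>x) \<otimes> T)) (t *\<^sub>R \<sigma>\<^sub>x)"
    by (auto simp: acts_as_def kron_def cscale_def T_def forall_2 mult_ac
        scaleR_conv_of_real[where 'a = complex])
  then show "acts_as 1 (mexp (t *\<^sub>R ((\<i> *\<^sub>C \<sigma>\<^sub>x) \<otimes> T))) (mexp (t *\<^sub>R \<sigma>\<^sub>x))"
    by (rule acts_as_mexp)
qed

text \<open>Each Euler factor lifts to the group on the same slice, so the product of the lifts acts
  as \<open>V\<close>.\<close>

lemma exp_group_acts_as_special_unitary:
  assumes "special_unitary V"
  shows "\<exists>X\<in>exp_group dyn_algebra. acts_as 1 X V"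
  using special_unitary_euler[OF assms] exp_group_acts_as_sigma_z exp_group_acts_as_sigma_x
  by (metis acts_as_mult exp_group_mult)

theorem proposition5p2:
  shows "pure_UIC dyn_algebra \<and>
    (\<forall>(\<rho>\<^sub>S :: complex^2^2) (X\<^sub>S :: complex^2^2).
       density_matrix \<rho>\<^sub>S \<longrightarrow> special_unitary X\<^sub>S \<longrightarrow>
       (\<exists>\<rho>\<^sub>A :: complex^2^2. pure_state \<rho>\<^sub>A \<and>
         (\<exists>X \<in> exp_group dyn_algebra.
            partial_trace_A (X ** (\<rho>\<^sub>S \<otimes> \<rho>\<^sub>A) ** X\<^sup>\<dagger>) = X\<^sub>S ** \<rho>\<^sub>S ** X\<^sub>S\<^sup>\<dagger>)))"
proof -
  have main: "\<exists>\<rho>\<^sub>A :: complex^2^2. pure_state \<rho>\<^sub>A \<and> (\<exists>X \<in> exp_group dyn_algebra.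
      partial_trace_A (X ** (R \<otimes> \<rho>\<^sub>A) ** X\<^sup>\<dagger>) = V ** R ** V\<^sup>\<dagger>)"
    if "special_unitary V" for V R :: "complex^2^2"
    using exp_group_acts_as_special_unitary[OF that] pure_state_basis_projector
      partial_trace_A_acts_as by meson
  \<comment> \<open>A unitary equivalence is rescaled by a phase into SU(2), which leaves the
    conjugated state unchanged, and then \<open>main\<close> applies.\<close>
  moreover have "pure_UIC dyn_algebra"
    unfolding pure_UIC_def UIC_def
    using main unitary_phase_special_unitary cscale_conj by (metis mem_Collect_eq)
  ultimately show ?thesis by blast
qed

end
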